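(* Let $n\ge1$ and let $C$ be a dominating set of the queen's graph $Q_n$. Put $$\delta(C)=\min_{p,q\in\{0,1\}}\max\{a_p(C),b_q(C)\},$$ where $a_p(C)$ is the number of columns of parity $p$ containing no element of $C$ and $b_q(C)$ is the number of rows of parity $q$ containing no element of $C$. Then $\delta(C)$ is exactly the minimum number of additional queens required to extend $C$ to an orthodox cover; that is, $$\delta(C)=\min\{|C'\setminus C| : C'\supseteq C,\ C' \text{ is an orthodox cover of } Q_n\}.$$
   Context: The queen's graph $Q_n$ has as vertices the squares $(x,y)\in\{0,\ldots,n-1\}^2$ of the $n\times n$ chessboard ($x$ is the column index, $y$ the row index); two distinct squares are adjacent if they share a row, a column, or a diagonal ($y-x$ equal or $x+y$ equal). A set of squares (queens) is a dominating set if every square belongs to it or is adjacent to one of its squares. The parity of a row or column is the parity of its index. A dominating set is an orthodox cover if there exist $p,q\in\{0,1\}$ (possibly different) such that every column of parity $p$ and every row of parity $q$ contains one of its queens. *)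

theory Defs
  imports Main
begin

definition board :: "nat \<Rightarrow> (nat \<times> nat) set" where
  "board n = {0..<n} \<times> {0..<n}"

(* Squares are pairs (column, row); the difference diagonal is compared over the
   integers because subtraction on nat truncates. *)
definition queen_adj :: "nat \<times> nat \<Rightarrow> nat \<times> nat \<Rightarrow> bool" where
  "queen_adj s t \<longleftrightarrow> s \<noteq> t \<and>
     (fst s = fst t \<or> snd s = snd t \<or>
      int (snd s) - int (fst s) = int (snd t) - int (fst t) \<or>
      fst s + snd s = fst t + snd t)"

definition dominating_set :: "'a set \<Rightarrow> ('a \<Rightarrow> 'a \<Rightarrow> bool) \<Rightarrow> 'a set \<Rightarrow> bool" where
  "dominating_set V adj C \<longleftrightarrow> C \<subseteq> V \<and> (\<forall>v\<in>V. v \<in> C \<or> (\<exists>c\<in>C. adj v c))"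

definition queen_dominating :: "nat \<Rightarrow> (nat \<times> nat) set \<Rightarrow> bool" where
  "queen_dominating n C \<longleftrightarrow> dominating_set (board n) queen_adj C"

definition orthodox_cover :: "nat \<Rightarrow> (nat \<times> nat) set \<Rightarrow> bool" where
  "orthodox_cover n C \<longleftrightarrow> queen_dominating n C \<and>
     (\<exists>p\<in>{0, 1}. \<exists>q\<in>{0, 1}.
        (\<forall>x<n. x mod 2 = p \<longrightarrow> (\<exists>y. (x, y) \<in> C)) \<and>
        (\<forall>y<n. y mod 2 = q \<longrightarrow> (\<exists>x. (x, y) \<in> C)))"

definition empty_columns :: "nat \<Rightarrow> (nat \<times> nat) set \<Rightarrow> nat \<Rightarrow> nat" where
  "empty_columns n C p = card {x. x < n \<and> x mod 2 = p \<and> (\<forall>y. (x, y) \<notin> C)}"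

definition empty_rows :: "nat \<Rightarrow> (nat \<times> nat) set \<Rightarrow> nat \<Rightarrow> nat" where
  "empty_rows n C q = card {y. y < n \<and> y mod 2 = q \<and> (\<forall>x. (x, y) \<notin> C)}"

definition delta :: "nat \<Rightarrow> (nat \<times> nat) set \<Rightarrow> nat" where
  "delta n C =
     Min ((\<lambda>(p, q). max (empty_columns n C p) (empty_rows n C q)) ` ({0, 1} \<times> {0, 1}))"

(* Min is only meaningful on finite nonempty sets; the next two facts show that the
   set of costs of orthodox extensions of C is one. *)
lemma finite_extension_costs:
  "finite {card (C' - C) | C'. C \<subseteq> C' \<and> orthodox_cover n C'}" (is "finite ?S")
proof -
  have "?S \<subseteq> (\<lambda>C'. card (C' - C)) ` Pow (board n)"
    by (auto simp: orthodox_cover_def queen_dominating_def dominating_set_def)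
  moreover have "finite (Pow (board n))"
    by (simp add: board_def)
  ultimately show ?thesis
    by (meson finite_imageI finite_subset)
qed

lemma extension_costs_nonempty:
  assumes "C \<subseteq> board n"
  shows "{card (C' - C) | C'. C \<subseteq> C' \<and> orthodox_cover n C'} \<noteq> {}"
proof -
  have "orthodox_cover n (board n)"
    by (auto simp: orthodox_cover_def queen_dominating_def dominating_set_def board_def)
  with assms show ?thesis
    by auto
qed

end

theory Submission
  imports Defs
begin

text \<open>
  A superset of a dominating set inside the board is again dominating, so extending \<open>C\<close> to an
  orthodox cover is purely a matter of occupying lines: for some parities \<open>p\<close> and \<open>q\<close>, the new
  queens must hit all empty columns of parity \<open>p\<close> and all empty rows of parity \<open>q\<close>. One queen
  hits at most one line of each kind, which gives the lower bound \<open>max a\<^sub>p b\<^sub>q\<close>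
  (\<open>empty_columns_le\<close>, \<open>empty_rows_le\<close>). Conversely one queen can be
  placed at the crossing of any column with any row, so empty columns and empty rows can be
  paired off, and \<open>max a\<^sub>p b\<^sub>q\<close> queens suffice (\<open>cover_both_projections\<close>).
  Minimising over \<open>p\<close> and \<open>q\<close> gives the theorem.
\<close>

lemma ex_map_covering:
  assumes "finite A" "finite B" "card A \<le> card B" "A \<subseteq> S" "S \<noteq> {}"
  shows "\<exists>f. f ` B \<subseteq> S \<and> A \<subseteq> f ` B"
proof -
  obtain s where s: "s \<in> S" using assms(5) by blast
  obtain g where g: "g ` A \<subseteq> B" "inj_on g A"
    using card_le_inj[OF assms(1-3)] by blast
  \<comment> \<open>A left inverse of \<open>g\<close>; it takes a default value in \<open>S\<close> where \<open>A\<close> has been used up.\<close>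
  define f where "f b = (if b \<in> g ` A then inv_into A g b else s)" for b
  have "f ` B \<subseteq> S"
    using s assms(4) by (auto simp: f_def g(2))
  moreover have "a \<in> f ` B" if "a \<in> A" for a
    using that g by (intro image_eqI[of _ _ "g a"]) (auto simp: f_def)
  ultimately show ?thesis by blast
qed

text \<open>
  The graph of a map from the larger of two sets that covers the smaller one projects onto both,
  and has only as many points as the larger set. Nonemptiness of \<open>S\<close> and \<open>T\<close> provides the other
  coordinate of the points left unpaired.
\<close>

lemma cover_both_projections:
  assumes "finite X" "finite Y" "X \<subseteq> S" "Y \<subseteq> T" "S \<noteq> {}" "T \<noteq> {}"
  shows "\<exists>D. D \<subseteq> S \<times> T \<and> finite D \<and> card D = max (card X) (card Y) \<and>
             X \<subseteq> fst ` D \<and> Y \<subseteq> snd ` D"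
proof (cases "card X \<le> card Y")
  case True
  then obtain f where f: "f ` Y \<subseteq> S" "X \<subseteq> f ` Y"
    using ex_map_covering[of X Y S] assms by blast
  have "card ((\<lambda>y. (f y, y)) ` Y) = card Y"
    by (intro card_image inj_onI) simp
  with f True assms show ?thesis
    by (intro exI[of _ "(\<lambda>y. (f y, y)) ` Y"]) (auto simp: image_image)
next
  case False
  then obtain f where f: "f ` X \<subseteq> T" "Y \<subseteq> f ` X"
    using ex_map_covering[of Y X T] assms by fastforce
  have "card ((\<lambda>x. (x, f x)) ` X) = card X"
    by (intro card_image inj_onI) simp
  with f False assms show ?thesis
    by (intro exI[of _ "(\<lambda>x. (x, f x)) ` X"]) (auto simp: image_image)
qed

lemma queen_dominating_superset:
  assumes "queen_dominating n C" "C \<subseteq> C'" "C' \<subseteq> board n"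
  shows "queen_dominating n C'"
  using assms unfolding queen_dominating_def dominating_set_def by blast

text \<open>The new queens project onto the lines of the prescribed parity that \<open>C\<close> leaves empty.\<close>

lemma empty_columns_le:
  assumes "finite C'" "\<forall>x<n. x mod 2 = p \<longrightarrow> (\<exists>y. (x, y) \<in> C')"
  shows "empty_columns n C p \<le> card (C' - C)"
proof -
  have "{x. x < n \<and> x mod 2 = p \<and> (\<forall>y. (x, y) \<notin> C)} \<subseteq> fst ` (C' - C)"
    using assms(2) by force
  then show ?thesis
    using assms(1) unfolding empty_columns_def by (intro surj_card_le) auto
qed

lemma empty_rows_le:
  assumes "finite C'" "\<forall>y<n. y mod 2 = q \<longrightarrow> (\<exists>x. (x, y) \<in> C')"
  shows "empty_rows n C q \<le> card (C' - C)"
proof -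
  have "{y. y < n \<and> y mod 2 = q \<and> (\<forall>x. (x, y) \<notin> C)} \<subseteq> snd ` (C' - C)"
    using assms(2) by force
  then show ?thesis
    using assms(1) unfolding empty_rows_def by (intro surj_card_le) auto
qed

lemma orthodox_extension_exists:
  assumes "n \<ge> 1" "queen_dominating n C" "p \<in> {0, 1}" "q \<in> {0, 1}"
  shows "\<exists>C'. C \<subseteq> C' \<and> orthodox_cover n C' \<and>
              card (C' - C) \<le> max (empty_columns n C p) (empty_rows n C q)"
proof -
  define X where "X = {x. x < n \<and> x mod 2 = p \<and> (\<forall>y. (x, y) \<notin> C)}"
  define Y where "Y = {y. y < n \<and> y mod 2 = q \<and> (\<forall>x. (x, y) \<notin> C)}"
  have "finite X" "finite Y" "X \<subseteq> {0..<n}" "Y \<subseteq> {0..<n}" "{0..<n} \<noteq> {}"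
    using assms(1) by (auto simp: X_def Y_def)
  then obtain D where D: "D \<subseteq> {0..<n} \<times> {0..<n}" "finite D"
      "card D = max (card X) (card Y)" "X \<subseteq> fst ` D" "Y \<subseteq> snd ` D"
    using cover_both_projections[of X Y "{0..<n}" "{0..<n}"] by blast
  have "queen_dominating n (C \<union> D)"
    using assms(2) D(1)
    by (intro queen_dominating_superset[OF assms(2)])
       (auto simp: board_def queen_dominating_def dominating_set_def)
  moreover have "\<exists>y. (x, y) \<in> C \<union> D" if "x < n" "x mod 2 = p" for x
  proof (cases "x \<in> X")
    case True
    with D(4) show ?thesis by force
  next
    case False
    with that show ?thesis by (auto simp: X_def)
  qed
  moreover have "\<exists>x. (x, y) \<in> C \<union> D" if "y < n" "y mod 2 = q" for y
  proof (cases "y \<in> Y")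
    case True
    with D(5) show ?thesis by force
  next
    case False
    with that show ?thesis by (auto simp: Y_def)
  qed
  ultimately have "orthodox_cover n (C \<union> D)"
    unfolding orthodox_cover_def using assms(3,4) by blast
  moreover have "card (C \<union> D - C) \<le> card D"
    using D(2) by (intro card_mono) auto
  ultimately show ?thesis
    using D(3) unfolding X_def Y_def empty_columns_def empty_rows_def
    by (intro exI[of _ "C \<union> D"]) simp
qed

lemma delta_le:
  assumes "p \<in> {0, 1}" "q \<in> {0, 1}"
  shows "delta n C \<le> max (empty_columns n C p) (empty_rows n C q)"
  unfolding delta_def by (rule Min_le) (use assms in auto)

lemma delta_attained:
  obtains p q where "p \<in> {0, 1}" "q \<in> {0, 1}"
    "delta n C = max (empty_columns n C p) (empty_rows n C q)"
proof -
  have "delta n C \<in> (\<lambda>(p, q). max (empty_columns n C p) (empty_rows n C q)) ` ({0, 1} \<times> {0, 1})"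
    unfolding delta_def by (rule Min_in) auto
  then obtain z where "z \<in> {0, 1} \<times> {0, 1}"
    "delta n C = (case z of (p, q) \<Rightarrow> max (empty_columns n C p) (empty_rows n C q))"
    by (rule imageE)
  then show ?thesis
    using that[of "fst z" "snd z"] by (simp only: mem_Times_iff split_beta)
qed

lemma delta_le_extension_cost:
  assumes "orthodox_cover n C'"
  shows "delta n C \<le> card (C' - C)"
proof -
  have "C' \<subseteq> board n"
    using assms by (simp add: orthodox_cover_def queen_dominating_def dominating_set_def)
  then have fin: "finite C'"
    by (rule finite_subset) (simp add: board_def)
  obtain p q where pq: "p \<in> {0, 1}" "q \<in> {0, 1}"
      "\<forall>x<n. x mod 2 = p \<longrightarrow> (\<exists>y. (x, y) \<in> C')" "\<forall>y<n. y mod 2 = q \<longrightarrow> (\<exists>x. (x, y) \<in> C')"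
    using assms unfolding orthodox_cover_def by blast
  have "delta n C \<le> max (empty_columns n C p) (empty_rows n C q)"
    by (rule delta_le[OF pq(1,2)])
  also have "\<dots> \<le> card (C' - C)"
    using empty_columns_le[OF fin pq(3)] empty_rows_le[OF fin pq(4)] by simp
  finally show ?thesis .
qed

theorem mainTheorem5:
  fixes n :: nat and C :: "(nat \<times> nat) set"
  assumes "n \<ge> 1" and "queen_dominating n C"
  shows "delta n C = Min {card (C' - C) | C'. C \<subseteq> C' \<and> orthodox_cover n C'}"
proof (rule Min_eqI[symmetric])
  show "finite {card (C' - C) | C'. C \<subseteq> C' \<and> orthodox_cover n C'}"
    by (rule finite_extension_costs)
  show "delta n C \<le> k" if "k \<in> {card (C' - C) | C'. C \<subseteq> C' \<and> orthodox_cover n C'}" for k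
    using that delta_le_extension_cost by blast
  obtain p q where "p \<in> {0, 1}" "q \<in> {0, 1}"
    and eq: "delta n C = max (empty_columns n C p) (empty_rows n C q)"
    by (rule delta_attained)
  then obtain C' where C': "C \<subseteq> C'" "orthodox_cover n C'" "card (C' - C) \<le> delta n C"
    using orthodox_extension_exists[OF assms] by metis
  with delta_le_extension_cost[OF C'(2)] have "delta n C = card (C' - C)"
    by (meson le_antisym)
  with C' show "delta n C \<in> {card (C' - C) | C'. C \<subseteq> C' \<and> orthodox_cover n C'}"
    by blast
qed

end
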